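(* Let $c=c(x)$ and $f=f(x)$ be infinitely differentiable functions of $x$ and let $D=\frac{d}{dx}$. For every $n\ge1$, $$(cD)^nf=\sum_{\mathbf e\in \mathrm I_n}\phi(\mathbf e).$$
   Context: $(cD)^n$ is the $n$-fold composition of the operator $g\mapsto c\cdot Dg$. Write $c_k=D^kc$ and $\mathbf f_k=D^kf$ for $k\ge0$ (so $c_0=c$, $\mathbf f_0=f$). $\mathrm I_n$ is the set of inversion sequences of length $n$, i.e. integer sequences $\mathbf e=(e_1,\ldots,e_n)$ with $0\le e_i<i$ for all $1\le i\le n$. For $\mathbf e\in\mathrm I_n$ and $j\ge 0$ let $|\mathbf e|_j=\#\{i : 1\le i\le n,\ e_i=j\}$. Define $$\phi(\mathbf e)=c\cdot c_{|\mathbf e|_1}c_{|\mathbf e|_2}\cdots c_{|\mathbf e|_{n-1}}\cdot\mathbf f_{|\mathbf e|_0}.$$ *)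

theory Defs
  imports "HOL-Analysis.Analysis"
begin

(* Only used for open S, where the derivatives at points of S do not depend on the
   values outside S. *)
definition infinitely_differentiable_on ::
  "('a::real_normed_field \<Rightarrow> 'a) \<Rightarrow> 'a set \<Rightarrow> bool" where
  "infinitely_differentiable_on f S \<longleftrightarrow>
     (\<forall>k. \<forall>x\<in>S. (deriv ^^ k) f field_differentiable (at x))"

definition cD :: "('a::real_normed_field \<Rightarrow> 'a) \<Rightarrow> ('a \<Rightarrow> 'a) \<Rightarrow> ('a \<Rightarrow> 'a)" where
  "cD c g = (\<lambda>x. c x * deriv g x)"

(* Sequences (e 1, ..., e n) as functions on the index set {1..n}; PiE makes them
   undefined elsewhere, so that each sequence is represented exactly once. *)
definition inversion_seqs :: "nat \<Rightarrow> (nat \<Rightarrow> nat) set" where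
  "inversion_seqs n = (\<Pi>\<^sub>E i\<in>{1..n}. {0..<i})"

definition occ :: "nat \<Rightarrow> (nat \<Rightarrow> nat) \<Rightarrow> nat \<Rightarrow> nat" where
  "occ n e j = card {i \<in> {1..n}. e i = j}"

definition phi ::
  "('a::real_normed_field \<Rightarrow> 'a) \<Rightarrow> ('a \<Rightarrow> 'a) \<Rightarrow> nat \<Rightarrow> (nat \<Rightarrow> nat) \<Rightarrow> 'a \<Rightarrow> 'a" where
  "phi c f n e = (\<lambda>x. c x * (\<Prod>j\<in>{1..n-1}. (deriv ^^ occ n e j) c x)
                        * (deriv ^^ occ n e 0) f x)"

end

theory Submission
  imports Defs
begin

text \<open>Put weight \<^term>\<open>f\<close> on the letter 0 and \<^term>\<open>c\<close> on every positive letter. The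
  letter \<^term>\<open>n\<close> does not occur in an inversion sequence of length \<^term>\<open>n\<close>, so the leading
  factor \<^term>\<open>c\<close> of the weight is the factor of that letter, and the weight is a
  plain product over the letters \<open>0, \<dots>, n\<close>. By the product rule, differentiating it and
  multiplying by \<^term>\<open>c\<close> sums over the letter \<open>k \<le> n\<close> whose factor is differentiated,
  and this is the sum over all extensions of the sequence by \<open>e (Suc n) = k\<close>; the new
  letter \<^term>\<open>Suc n\<close> supplies the new factor \<^term>\<open>c\<close>.\<close>

text \<open>Unlike \<open>phi\<close>, which has a spurious factor \<open>c\<close> at
  \<open>n = 0\<close>, this product reduces there to \<open>f\<close> alone, so the induction can
  start at 0.\<close>

definition letter_weight ::
  "('a::real_normed_field \<Rightarrow> 'a) \<Rightarrow> ('a \<Rightarrow> 'a) \<Rightarrow> nat \<Rightarrow> (nat \<Rightarrow> nat) \<Rightarrow> 'a \<Rightarrow> 'a" where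
  "letter_weight c f n e x =
     (\<Prod>j\<in>{0..n}. (deriv ^^ occ n e j) (if j = 0 then f else c) x)"

lemma occ_eq_0:
  assumes "e \<in> inversion_seqs n" "n \<le> j"
  shows "occ n e j = 0"
proof -
  have "e i < i" if "i \<in> {1..n}" for i
    using PiE_mem[of e "{1..n}" _ i] assms(1) that by (force simp: inversion_seqs_def)
  then have "{i \<in> {1..n}. e i = j} = {}"
    using assms(2) by fastforce
  then show ?thesis unfolding occ_def by (simp only: card.empty)
qed

lemma letter_weight_eq_phi:
  assumes "e \<in> inversion_seqs n" "n \<ge> 1"
  shows "letter_weight c f n e x = phi c f n e x"
proof -
  \<comment> \<open>Letters 0 and \<open>n\<close> are distinct since \<open>n \<ge> 1\<close>;
    letter \<open>n\<close> contributes the undifferentiated \<open>c\<close>.\<close>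
  have "{0..n} = insert 0 (insert n {1..n-1})"
    using assms(2) by auto
  then show ?thesis
    using assms by (simp add: letter_weight_def phi_def occ_eq_0 mult_ac)
qed

lemma occ_extend: "occ (Suc n) (e(Suc n := k)) j = occ n e j + of_bool (j = k)"
proof -
  have "{i \<in> {1..Suc n}. (e(Suc n := k)) i = j} =
      {i \<in> {1..n}. e i = j} \<union> (if j = k then {Suc n} else {})"
    by (auto simp: le_Suc_eq)
  then show ?thesis
    unfolding occ_def by (auto simp: card_insert_if)
qed

lemma sum_inversion_seqs_Suc:
  "(\<Sum>e\<in>inversion_seqs (Suc n). F e) =
     (\<Sum>e\<in>inversion_seqs n. \<Sum>k\<in>{0..n}. F (e(Suc n := k)))"
proof -
  have eq: "inversion_seqs (Suc n) =
      (\<lambda>(k, e). e(Suc n := k)) ` ({0..n} \<times> inversion_seqs n)"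
    by (simp add: inversion_seqs_def atLeastAtMostSuc_conv PiE_insert_eq
        atLeastLessThanSuc_atLeastAtMost)
  \<comment> \<open>Sequences of length \<open>n\<close> are all \<open>undefined\<close> at
    \<open>Suc n\<close>, so overwriting that value loses no information.\<close>
  have inj: "inj_on (\<lambda>(k, e). e(Suc n := k)) ({0..n} \<times> inversion_seqs n)"
    using inj_combinator[of "Suc n" "{1..n}" "\<lambda>i. {0..<i}"]
    by (simp add: inversion_seqs_def atLeastLessThanSuc_atLeastAtMost)
  show ?thesis
    unfolding eq sum.reindex[OF inj]
    by (subst sum.swap) (simp add: sum.cartesian_product case_prod_unfold)
qed

lemma deriv_funpow_has_field_derivative:
  assumes "infinitely_differentiable_on g S" "x \<in> S"
  shows "((deriv ^^ k) g has_field_derivative (deriv ^^ Suc k) g x) (at x)"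
  using assms by (simp add: infinitely_differentiable_on_def DERIV_deriv_iff_field_differentiable)

lemma letter_weight_has_field_derivative:
  assumes "infinitely_differentiable_on c S" "infinitely_differentiable_on f S" "x \<in> S"
  shows "(letter_weight c f n e has_field_derivative
      (\<Sum>k\<in>{0..n}. \<Prod>j\<in>{0..n}.
         (deriv ^^ (occ n e j + of_bool (j = k))) (if j = 0 then f else c) x)) (at x)"
proof -
  define h where "h j = (if j = 0 then f else c)" for j :: nat
  have d: "((deriv ^^ m) (h j) has_field_derivative (deriv ^^ Suc m) (h j) x) (at x)" for m j
    using assms by (auto simp: h_def simp del: funpow.simps intro!: deriv_funpow_has_field_derivative)
  have "((\<lambda>x. \<Prod>j\<in>{0..n}. (deriv ^^ occ n e j) (h j) x) has_field_derivative
      (\<Sum>k\<in>{0..n}. (deriv ^^ Suc (occ n e k)) (h k) x *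
         (\<Prod>j\<in>{0..n} - {k}. (deriv ^^ occ n e j) (h j) x))) (at x)"
    by (rule has_field_derivative_prod[OF d])
  also have "(\<Sum>k\<in>{0..n}. (deriv ^^ Suc (occ n e k)) (h k) x *
         (\<Prod>j\<in>{0..n} - {k}. (deriv ^^ occ n e j) (h j) x)) =
      (\<Sum>k\<in>{0..n}. \<Prod>j\<in>{0..n}. (deriv ^^ (occ n e j + of_bool (j = k))) (h j) x)"
    \<comment> \<open>Splitting off \<open>j = k\<close> isolates the only factor whose order is
      raised by \<open>of_bool\<close>.\<close>
    by (intro sum.cong refl) (simp add: prod.remove)
  finally show ?thesis
    by (simp add: letter_weight_def[abs_def] h_def)
qed

text \<open>The factor \<open>c x\<close> is that of letter \<open>Suc n\<close>: it does not occur
  in \<open>e\<close>, and \<open>k \<le> n\<close> keeps it absent from the extension.\<close>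

lemma letter_weight_extend:
  assumes "e \<in> inversion_seqs n" "k \<le> n"
  shows "letter_weight c f (Suc n) (e(Suc n := k)) x =
    c x * (\<Prod>j\<in>{0..n}. (deriv ^^ (occ n e j + of_bool (j = k))) (if j = 0 then f else c) x)"
  using assms by (simp add: letter_weight_def occ_extend occ_eq_0)

lemma cD_funpow_eq_sum_letter_weight:
  assumes "open S" "infinitely_differentiable_on c S" "infinitely_differentiable_on f S" "x \<in> S"
  shows "(cD c ^^ n) f x = (\<Sum>e\<in>inversion_seqs n. letter_weight c f n e x)"
  using \<open>x \<in> S\<close>
proof (induction n arbitrary: x)
  case 0
  then show ?case
    by (simp add: inversion_seqs_def letter_weight_def occ_def)
next
  case (Suc n)
  let ?D = "\<lambda>e. \<Sum>k\<in>{0..n}. \<Prod>j\<in>{0..n}.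
    (deriv ^^ (occ n e j + of_bool (j = k))) (if j = 0 then f else c) x"
  have "((\<lambda>x. \<Sum>e\<in>inversion_seqs n. letter_weight c f n e x) has_field_derivative
      (\<Sum>e\<in>inversion_seqs n. ?D e)) (at x)"
    by (intro DERIV_sum letter_weight_has_field_derivative[OF assms(2,3) Suc.prems])
  \<comment> \<open>The induction hypothesis gives equality only on \<open>S\<close>; openness makes
    it hold near \<open>x\<close>, so the derivatives at \<open>x\<close> agree.\<close>
  then have "((cD c ^^ n) f has_field_derivative (\<Sum>e\<in>inversion_seqs n. ?D e)) (at x)"
    by (rule has_field_derivative_transform_within_open[OF _ assms(1) Suc.prems])
       (simp add: Suc.IH)
  then have "(cD c ^^ Suc n) f x = c x * (\<Sum>e\<in>inversion_seqs n. ?D e)"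
    by (simp add: cD_def DERIV_imp_deriv)
  also have "\<dots> = (\<Sum>e\<in>inversion_seqs n. \<Sum>k\<in>{0..n}. letter_weight c f (Suc n) (e(Suc n := k)) x)"
    by (simp add: sum_distrib_left letter_weight_extend)
  finally show ?case
    by (simp only: sum_inversion_seqs_Suc)
qed

theorem theorem5:
  fixes c f :: "'a::real_normed_field \<Rightarrow> 'a" and S :: "'a set" and n :: nat
  assumes "open S"
    and "infinitely_differentiable_on c S"
    and "infinitely_differentiable_on f S"
    and "n \<ge> 1"
  shows "\<forall>x\<in>S. (cD c ^^ n) f x = (\<Sum>e\<in>inversion_seqs n. phi c f n e x)"
  using assms by (simp add: cD_funpow_eq_sum_letter_weight letter_weight_eq_phi)

end
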